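(* Let $\alpha\colon I\subset\mathbb{R}\to\mathbb{H}^3$ be a regular curve with curvature $\kappa$ and torsion $\tau$. Then $\alpha$ is contained in a totally geodesic plane of $\mathbb{H}^3$ if and only if $\tau=0$ identically on $I$. If $\tau\neq0$ and $\kappa'\neq0$ everywhere on $I$, then $\alpha$ is contained in a totally umbilical, non-totally-geodesic surface of $\mathbb{H}^3$ if and only if $$\frac{\tau}{\kappa}-\left(\frac{\kappa'}{\kappa^2\tau}\right)'=0\quad\text{on } I.$$
   Context: Model: endow $\mathbb{R}^4$ with the Lorentzian metric $\langle\cdot,\cdot\rangle=dx_1^2+dx_2^2+dx_3^2-dx_4^2$. Hyperbolic space is $\mathbb{H}^3=\{p\in\mathbb{R}^4:\langle p,p\rangle=-1,\ x_4>0\}$ with the induced Riemannian metric and Levi-Civita connection $\nabla$. Totally umbilical surfaces: these are the (nonempty) sets $U_{\vec a,\sigma}=\{p\in\mathbb{H}^3:\langle p,\vec a\rangle=\sigma\}$ with $\sigma\in\mathbb{R}$, $\vec a\in\mathbb{R}^4$, $\vec a\neq0$, $\langle\vec a,\vec a\rangle=\epsilon\in\{-1,0,1\}$, of one of the following types: totally geodesic planes ($\epsilon=1$, $\sigma=0$); equidistant surfaces ($\epsilon=1$, $\sigma\neq0$); horospheres ($\epsilon=0$, $\sigma\neq0$); geodesic spheres ($\epsilon=-1$, $|\sigma|>1$). The non-totally-geodesic ones are the last three types. Curves: $I$ is an open interval; curves are of class at least $C^4$, parametrized by arc length $s$, and non-geodesic in the sense that $\kappa>0$ everywhere. The prime denotes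 $d/ds$. The curvature $\kappa$ and torsion $\tau$ are defined by the Frenet frame $\{T,N,B\}$ (orthonormal frame of $\mathbb{H}^3$ along $\alpha$, $T=\alpha'$, positively oriented for a fixed orientation) with $\nabla_TT=\kappa N$, $\nabla_TN=-\kappa T+\tau B$, $\nabla_TB=-\tau N$. "$\alpha$ is contained in $S$" means $\alpha(I)\subset S$. *)

theory Defs
  imports "HOL-Analysis.Analysis"
begin

definition lor :: "real^4 \<Rightarrow> real^4 \<Rightarrow> real" where
  "lor x y = x$1 * y$1 + x$2 * y$2 + x$3 * y$3 - x$4 * y$4"

definition hyp3 :: "(real^4) set" where
  "hyp3 = {p. lor p p = -1 \<and> p$4 > 0}"

subsection \<open>Totally umbilical surfaces\<close>

text \<open>
  The causal types and normalisations of \<open>a\<close>, and the nonemptiness of the surface, are imposed in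
  the individual types below, not in \<open>umb\<close>.
\<close>

definition umb :: "real^4 \<Rightarrow> real \<Rightarrow> (real^4) set" where
  "umb a \<sigma> = {p \<in> hyp3. lor p a = \<sigma>}"

definition totally_geodesic_plane :: "(real^4) set \<Rightarrow> bool" where
  "totally_geodesic_plane S \<longleftrightarrow> S \<noteq> {} \<and> (\<exists>a. lor a a = 1 \<and> S = umb a 0)"

definition equidistant_surface :: "(real^4) set \<Rightarrow> bool" where
  "equidistant_surface S \<longleftrightarrow> S \<noteq> {} \<and> (\<exists>a \<sigma>. lor a a = 1 \<and> \<sigma> \<noteq> 0 \<and> S = umb a \<sigma>)"

definition horosphere :: "(real^4) set \<Rightarrow> bool" where
  "horosphere S \<longleftrightarrow> S \<noteq> {} \<and> (\<exists>a \<sigma>. a \<noteq> 0 \<and> lor a a = 0 \<and> \<sigma> \<noteq> 0 \<and> S = umb a \<sigma>)"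

definition geodesic_sphere :: "(real^4) set \<Rightarrow> bool" where
  "geodesic_sphere S \<longleftrightarrow> S \<noteq> {} \<and> (\<exists>a \<sigma>. lor a a = -1 \<and> \<bar>\<sigma>\<bar> > 1 \<and> S = umb a \<sigma>)"

definition totally_umbilical_surface :: "(real^4) set \<Rightarrow> bool" where
  "totally_umbilical_surface S \<longleftrightarrow>
     totally_geodesic_plane S \<or> equidistant_surface S \<or> horosphere S \<or> geodesic_sphere S"

subsection \<open>Curves\<close>

text \<open>Used only for open \<open>I\<close>, where derivatives at a point depend on \<open>f\<close> restricted to \<open>I\<close>.\<close>

fun Ck_on :: "nat \<Rightarrow> real set \<Rightarrow> (real \<Rightarrow> real^4) \<Rightarrow> bool" where
  "Ck_on 0 I f \<longleftrightarrow> continuous_on I f"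
| "Ck_on (Suc k) I f \<longleftrightarrow>
     (\<exists>f'. (\<forall>s\<in>I. (f has_vector_derivative f' s) (at s)) \<and> Ck_on k I f')"

definition velocity :: "(real \<Rightarrow> real^4) \<Rightarrow> real \<Rightarrow> real^4" where
  "velocity \<alpha> s = vector_derivative \<alpha> (at s)"

definition arclength_curve :: "real set \<Rightarrow> (real \<Rightarrow> real^4) \<Rightarrow> bool" where
  "arclength_curve I \<alpha> \<longleftrightarrow> Ck_on 4 I \<alpha> \<and> \<alpha> ` I \<subseteq> hyp3 \<and>
     (\<forall>s\<in>I. lor (velocity \<alpha> s) (velocity \<alpha> s) = 1)"

text \<open>
  The Levi-Civita connection of a nondegenerate submanifold of flat Lorentzian space is the
  tangential part of the flat connection. The normal line of hyperbolic space at \<open>p\<close> is spanned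
  by \<open>p\<close> itself, and \<open>lor p p = -1\<close>, so the tangential part of \<open>w\<close> at \<open>p\<close> is \<open>w + lor w p *\<^sub>R p\<close>.
\<close>

definition cov_deriv :: "(real \<Rightarrow> real^4) \<Rightarrow> (real \<Rightarrow> real^4) \<Rightarrow> real \<Rightarrow> real^4" where
  "cov_deriv \<alpha> V s =
     (let w = vector_derivative V (at s) in w + lor w (\<alpha> s) *\<^sub>R \<alpha> s)"

definition tangent_at :: "real^4 \<Rightarrow> (real^4) set" where
  "tangent_at p = {v. lor v p = 0}"

text \<open>
  The two orientations of hyperbolic space are indexed by a sign \<open>\<omega>\<close>: a tangent frame at \<open>p\<close>
  is positive if, completed by the normal \<open>p\<close>, it has determinant of sign \<open>\<omega>\<close> in the ambient space.
\<close>

definition positive_orthonormal_frame ::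
  "real \<Rightarrow> real^4 \<Rightarrow> real^4 \<Rightarrow> real^4 \<Rightarrow> real^4 \<Rightarrow> bool" where
  "positive_orthonormal_frame \<omega> p u v w \<longleftrightarrow>
     u \<in> tangent_at p \<and> v \<in> tangent_at p \<and> w \<in> tangent_at p \<and>
     lor u u = 1 \<and> lor v v = 1 \<and> lor w w = 1 \<and>
     lor u v = 0 \<and> lor u w = 0 \<and> lor v w = 0 \<and>
     \<omega> * det (vector [u, v, w, p] :: real^4^4) > 0"

text \<open>
  The differentiability clauses make the covariant derivatives meaningful; for a \<open>C\<^sup>4\<close> curve of
  nonvanishing geodesic curvature they hold for its (unique) Frenet frame with \<open>\<kappa> > 0\<close>.
\<close>

definition frenet_apparatus ::
  "real \<Rightarrow> real set \<Rightarrow> (real \<Rightarrow> real^4) \<Rightarrow> (real \<Rightarrow> real^4) \<Rightarrow> (real \<Rightarrow> real^4) \<Rightarrow> (real \<Rightarrow> real^4)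
     \<Rightarrow> (real \<Rightarrow> real) \<Rightarrow> (real \<Rightarrow> real) \<Rightarrow> bool" where
  "frenet_apparatus \<omega> I \<alpha> T N B \<kappa> \<tau> \<longleftrightarrow>
     (\<forall>s\<in>I.
        positive_orthonormal_frame \<omega> (\<alpha> s) (T s) (N s) (B s) \<and>
        T differentiable (at s) \<and> N differentiable (at s) \<and> B differentiable (at s) \<and>
        T s = velocity \<alpha> s \<and>
        cov_deriv \<alpha> T s = \<kappa> s *\<^sub>R N s \<and>
        cov_deriv \<alpha> N s = - \<kappa> s *\<^sub>R T s + \<tau> s *\<^sub>R B s \<and>
        cov_deriv \<alpha> B s = - \<tau> s *\<^sub>R N s)"

end

theory Submission
  imports Defs
begin

text \<open>
  Everything is computed in the flat ambient space. Since \<open>lor (\<alpha> s) (\<alpha> s) = -1\<close>, undoing the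
  tangential projection in the Frenet equations gives the linear system
  \<open>\<alpha>' = T\<close>, \<open>T' = \<kappa> N + \<alpha>\<close>, \<open>N' = - \<kappa> T + \<tau> B\<close>, \<open>B' = - \<tau> N\<close>
  (\<open>frenet_equations\<close>), and a curve lies in an umbilical surface precisely when its height
  \<open>lor (\<alpha> s) a\<close> in the direction of a suitable fixed vector \<open>a\<close> is constant.

  If the height is constantly \<open>\<sigma>\<close>, differentiating it repeatedly determines the remaining
  components of \<open>a\<close> in the frame: \<open>lor T a = 0\<close>, then \<open>lor N a = - \<sigma> / \<kappa>\<close>, then
  \<open>\<tau> * lor B a = \<sigma> \<kappa>' / \<kappa>\<^sup>2\<close>. For \<open>\<sigma> = 0\<close> and \<open>\<tau> \<noteq> 0\<close> at some point this forces \<open>a\<close> to be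
  orthogonal to a basis, hence zero, so curves in totally geodesic planes have no torsion
  (\<open>torsion_zero_of_totally_geodesic\<close>). For \<open>\<sigma> \<noteq> 0\<close>, differentiating once more and dividing by
  \<open>\<sigma>\<close> gives the differential equation (\<open>curvature_equation_of_umbilical\<close>).

  Conversely, these formulas tell which vector must be constant. Without torsion it is \<open>B\<close>. If
  the differential equation holds, it is the vector
  \<open>- (1 / \<kappa>) N + (\<kappa>' / (\<kappa>\<^sup>2 \<tau>)) B - \<alpha>\<close>: the equation is the vanishing of the \<open>B\<close>
  component of its derivative, while the other components vanish identically
  (\<open>constant_height_of_curvature_equation\<close>). The curve has height 1 in this direction, and the
  Lorentzian square of the vector exceeds -1, so the level set is an equidistant surface, a
  horosphere or a geodesic sphere according to the sign of that square.
\<close>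

section \<open>The Lorentzian product\<close>

lemma bounded_bilinear_lor: "bounded_bilinear lor"
proof -
  have "bilinear lor"
    unfolding bilinear_def by (auto intro!: linearI simp: lor_def algebra_simps)
  then show ?thesis
    by (simp add: bilinear_conv_bounded_bilinear)
qed

interpretation lor: bounded_bilinear lor
  by (rule bounded_bilinear_lor)

lemma lor_commute: "lor x y = lor y x"
  by (simp add: lor_def algebra_simps)

lemmas lor_expand = lor.add_left lor.add_right lor.diff_left lor.diff_right
  lor.minus_left lor.minus_right lor.scaleR_left lor.scaleR_right

lemma lor_has_real_derivative:
  assumes "(f has_vector_derivative f') (at s)" "(g has_vector_derivative g') (at s)"
  shows "((\<lambda>t. lor (f t) (g t)) has_real_derivative lor (f s) g' + lor f' (g s)) (at s)"
  using lor.has_vector_derivative[OF assms]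
  by (simp add: has_real_derivative_iff_has_vector_derivative)

lemma derivatives_eq_on_open:
  fixes f g :: "real \<Rightarrow> real"
  assumes "open I" "s \<in> I" "\<And>t. t \<in> I \<Longrightarrow> f t = g t"
    and f: "(f has_real_derivative f') (at s)" and g: "(g has_real_derivative g') (at s)"
  shows "f' = g'"
proof -
  have "(g has_real_derivative f') (at s)"
    using f assms(1-3) by (rule has_field_derivative_transform_within_open)
  then show ?thesis
    using g by (rule DERIV_unique)
qed

text \<open>
  A positive determinant, up to the sign \<open>\<omega>\<close>, makes the four vectors a basis, and the Lorentzian
  product is nondegenerate.
\<close>

lemma orthogonal_to_frame_imp_zero:
  assumes frame: "positive_orthonormal_frame \<omega> p u v w"
    and orth: "lor u a = 0" "lor v a = 0" "lor w a = 0" "lor p a = 0"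
  shows "a = 0"
proof -
  define M :: "real^4^4" where "M = vector [u, v, w, p]"
  \<comment> \<open>Flipping the last coordinate turns Lorentzian products with \<open>a\<close> into Euclidean ones with \<open>b\<close>.\<close>
  define b :: "real^4" where "b = (\<chi> i. if i = 4 then - a $ 4 else a $ i)"
  have "det M \<noteq> 0"
    using frame by (auto simp: positive_orthonormal_frame_def M_def)
  then have "invertible M"
    by (simp add: invertible_det_nz)
  moreover have "M *v b = 0"
    using orth by (simp add: vec_eq_iff forall_4 matrix_vector_mult_def sum_4 M_def b_def
        vector_def lor_def)
  ultimately have "b = 0"
    using matrix_left_invertible_ker[of M] by (auto simp: invertible_def)
  then show ?thesis
    by (simp add: vec_eq_iff forall_4 b_def)
qed

section \<open>Level sets of linear height functions\<close>

lemma umb_scaleR: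
  assumes "c \<noteq> 0"
  shows "umb (c *\<^sub>R a) (c * \<sigma>) = umb a \<sigma>"
  using assms by (auto simp: umb_def lor.scaleR_right)

text \<open>
  Rescaling \<open>a\<close> to a unit vector multiplies the level 1 by \<open>c = 1 / sqrt \<bar>lor a a\<bar>\<close>. The sign of
  \<open>lor a a\<close> decides which type of surface arises, and \<open>lor a a > -1\<close> is exactly what makes
  \<open>c > 1\<close> when \<open>a\<close> is timelike, so that the level set is a genuine sphere.
\<close>

lemma totally_umbilical_surface_umb_1:
  assumes a: "lor a a > -1" and nonempty: "umb a 1 \<noteq> {}"
  shows "totally_umbilical_surface (umb a 1)"
proof -
  define c where "c = 1 / sqrt \<bar>lor a a\<bar>"
  have normal: "umb a 1 = umb (c *\<^sub>R a) c" "lor (c *\<^sub>R a) (c *\<^sub>R a) = lor a a / \<bar>lor a a\<bar>" "c > 0"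
    if "lor a a \<noteq> 0"
    using that umb_scaleR[of c a 1] by (auto simp: c_def lor_expand field_simps)
  consider "lor a a > 0" | "lor a a = 0" | "lor a a < 0"
    by linarith
  then show ?thesis
  proof cases
    case 1
    then have "equidistant_surface (umb a 1)"
      using nonempty normal unfolding equidistant_surface_def
      by (intro conjI exI[of _ "c *\<^sub>R a"] exI[of _ c]) auto
    then show ?thesis
      by (simp add: totally_umbilical_surface_def)
  next
    case 2
    moreover have "a \<noteq> 0"
      using nonempty by (auto simp: umb_def lor.zero_right)
    ultimately have "horosphere (umb a 1)"
      using nonempty unfolding horosphere_def
      by (intro conjI exI[of _ a] exI[of _ 1]) auto
    then show ?thesis
      by (simp add: totally_umbilical_surface_def)
  next
    case 3
    then have "c > 1"
      using a by (simp add: c_def)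
    then have "geodesic_sphere (umb a 1)"
      using 3 nonempty normal unfolding geodesic_sphere_def
      by (intro conjI exI[of _ "c *\<^sub>R a"] exI[of _ c]) auto
    then show ?thesis
      by (simp add: totally_umbilical_surface_def)
  qed
qed

section \<open>Curves with a Frenet frame\<close>

locale frenet_curve =
  fixes \<omega> :: real and I :: "real set" and \<alpha> T N B :: "real \<Rightarrow> real^4" and \<kappa> \<tau> :: "real \<Rightarrow> real"
  assumes open_I: "open I" and interval_I: "is_interval I" and nonempty_I: "I \<noteq> {}"
    and arclength: "arclength_curve I \<alpha>"
    and frenet: "frenet_apparatus \<omega> I \<alpha> T N B \<kappa> \<tau>"
    and curvature_pos: "s \<in> I \<Longrightarrow> \<kappa> s > 0"
begin

lemma in_hyp3: "s \<in> I \<Longrightarrow> \<alpha> s \<in> hyp3"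
  using arclength by (auto simp: arclength_curve_def)

lemma lor_curve: "s \<in> I \<Longrightarrow> lor (\<alpha> s) (\<alpha> s) = -1"
  using in_hyp3 by (simp add: hyp3_def)

lemma frame: "s \<in> I \<Longrightarrow> positive_orthonormal_frame \<omega> (\<alpha> s) (T s) (N s) (B s)"
  using frenet by (auto simp: frenet_apparatus_def)

lemma frame_products:
  assumes "s \<in> I"
  shows "lor (T s) (T s) = 1" "lor (N s) (N s) = 1" "lor (B s) (B s) = 1"
    "lor (T s) (N s) = 0" "lor (N s) (T s) = 0" "lor (T s) (B s) = 0" "lor (B s) (T s) = 0"
    "lor (N s) (B s) = 0" "lor (B s) (N s) = 0"
    "lor (T s) (\<alpha> s) = 0" "lor (\<alpha> s) (T s) = 0" "lor (N s) (\<alpha> s) = 0" "lor (\<alpha> s) (N s) = 0"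
    "lor (B s) (\<alpha> s) = 0" "lor (\<alpha> s) (B s) = 0"
  using frame[OF assms]
  by (simp_all add: positive_orthonormal_frame_def tangent_at_def lor_commute)

lemma curve_derivative:
  assumes "s \<in> I"
  shows "(\<alpha> has_vector_derivative T s) (at s)"
proof -
  obtain f' where "(\<alpha> has_vector_derivative f' s) (at s)"
    using arclength assms by (auto simp: arclength_curve_def numeral_eq_Suc)
  moreover have "T s = vector_derivative \<alpha> (at s)"
    using frenet assms by (auto simp: frenet_apparatus_def velocity_def)
  ultimately show ?thesis
    by (simp add: vector_derivative_at)
qed

text \<open>
  The component along \<open>\<alpha> s\<close> that the covariant derivative removes is recovered by differentiating
  the tangency condition \<open>lor (V t) (\<alpha> t) = 0\<close>.
\<close>

lemma tangential_field_derivative: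
  assumes s: "s \<in> I" and "V differentiable at s"
    and tangential: "\<And>t. t \<in> I \<Longrightarrow> lor (V t) (\<alpha> t) = 0"
  shows "(V has_vector_derivative cov_deriv \<alpha> V s + lor (V s) (T s) *\<^sub>R \<alpha> s) (at s)"
proof -
  define w where "w = vector_derivative V (at s)"
  have V: "(V has_vector_derivative w) (at s)"
    using assms(2) by (simp add: w_def vector_derivative_works)
  have "lor (V s) (T s) + lor w (\<alpha> s) = 0"
    by (rule derivatives_eq_on_open[OF open_I s tangential
          lor_has_real_derivative[OF V curve_derivative[OF s]]]) auto
  then have "w = cov_deriv \<alpha> V s + lor (V s) (T s) *\<^sub>R \<alpha> s"
    by (simp add: cov_deriv_def Let_def w_def add.assoc
        flip: scaleR_left_distrib)
  then show ?thesis
    using V by simp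
qed

lemma frenet_equations:
  assumes s: "s \<in> I"
  shows "(T has_vector_derivative \<kappa> s *\<^sub>R N s + \<alpha> s) (at s)"
    and "(N has_vector_derivative - \<kappa> s *\<^sub>R T s + \<tau> s *\<^sub>R B s) (at s)"
    and "(B has_vector_derivative - \<tau> s *\<^sub>R N s) (at s)"
  using tangential_field_derivative[OF s, of T] tangential_field_derivative[OF s, of N]
    tangential_field_derivative[OF s, of B] frenet s
  by (auto simp: frenet_apparatus_def frame_products)

lemma constant_of_zero_derivative:
  fixes f :: "real \<Rightarrow> real^4"
  assumes "\<And>s. s \<in> I \<Longrightarrow> (f has_vector_derivative 0) (at s)"
  obtains c where "\<And>s. s \<in> I \<Longrightarrow> f s = c"
proof (rule has_vector_derivative_zero_constant[of I f])
  show "convex I"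
    using interval_I by (rule is_interval_convex)
qed (use assms in \<open>auto intro: has_vector_derivative_at_within\<close>)

text \<open>
  Smoothness of \<open>\<kappa>\<close> and \<open>\<tau>\<close> is not part of the Frenet data; it comes from \<open>\<alpha>\<close> being \<open>C\<^sup>4\<close>.
  Each of \<open>\<kappa>\<close>, \<open>\<kappa>'\<close> and \<open>\<kappa> \<tau>\<close> is a product of a derivative of \<open>\<alpha>\<close> of order at most three
  with a frame vector, namely \<open>lor \<alpha>'' N\<close>, \<open>lor \<alpha>''' N\<close> and \<open>lor \<alpha>''' B\<close>, so one further
  derivative of each exists.
\<close>

lemma
  shows curvature_derivative: "\<And>s. s \<in> I \<Longrightarrow> (\<kappa> has_real_derivative deriv \<kappa> s) (at s)"
    and curvature_twice_differentiable: "\<And>s. s \<in> I \<Longrightarrow> deriv \<kappa> differentiable at s"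
    and torsion_differentiable: "\<And>s. s \<in> I \<Longrightarrow> \<tau> differentiable at s"
proof -
  obtain f1 f2 f3 f4 where f1: "\<And>s. s \<in> I \<Longrightarrow> (\<alpha> has_vector_derivative f1 s) (at s)"
    and f2: "\<And>s. s \<in> I \<Longrightarrow> (f1 has_vector_derivative f2 s) (at s)"
    and f3: "\<And>s. s \<in> I \<Longrightarrow> (f2 has_vector_derivative f3 s) (at s)"
    and f4: "\<And>s. s \<in> I \<Longrightarrow> (f3 has_vector_derivative f4 s) (at s)"
  proof -
    have "Ck_on (Suc (Suc (Suc (Suc 0)))) I \<alpha>"
      using arclength by (simp add: arclength_curve_def numeral_eq_Suc)
    then show ?thesis
      using that by (auto simp: Bex_def) metis
  qed
  have f1_eq: "f1 s = T s" if "s \<in> I" for s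
    using f1[OF that] curve_derivative[OF that] by (rule vector_derivative_unique_at)
  have f2_eq: "f2 s = \<kappa> s *\<^sub>R N s + \<alpha> s" if s: "s \<in> I" for s
  proof -
    have "(T has_vector_derivative f2 s) (at s)"
      using f2[OF s] open_I s f1_eq by (rule has_vector_derivative_transform_within_open)
    then show ?thesis
      using frenet_equations(1)[OF s] by (rule vector_derivative_unique_at)
  qed
  have \<kappa>': "(\<kappa> has_real_derivative lor (f3 s) (N s)) (at s)" if s: "s \<in> I" for s
  proof -
    have "((\<lambda>t. lor (f2 t) (N t)) has_real_derivative lor (f3 s) (N s)) (at s)"
      using lor_has_real_derivative[OF f3[OF s] frenet_equations(2)[OF s]]
      by (simp add: f2_eq s lor_expand frame_products)
    then show ?thesis
      using open_I s
      by (rule has_field_derivative_transform_within_open) (simp add: f2_eq lor_expand frame_products)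
  qed
  then show curvature_derivative': "(\<kappa> has_real_derivative deriv \<kappa> s) (at s)" if "s \<in> I" for s
    using that by (metis DERIV_imp_deriv)
  have differentiable: "f differentiable at s"
    if "(g has_real_derivative D) (at s)" "s \<in> I" "\<And>t. t \<in> I \<Longrightarrow> g t = f t" for f g D s
    using has_field_derivative_transform_within_open[OF that(1) open_I that(2,3)]
    by (auto simp: real_differentiable_def)
  show "deriv \<kappa> differentiable at s" if s: "s \<in> I" for s
    by (rule differentiable[OF lor_has_real_derivative[OF f4[OF s] frenet_equations(2)[OF s]] s])
      (use \<kappa>' DERIV_imp_deriv in metis)
  \<comment> \<open>Differentiate \<open>lor (f2 s) (B s) = 0\<close>.\<close>
  have binormal: "lor (f3 s) (B s) = \<kappa> s * \<tau> s" if s: "s \<in> I" for s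
  proof -
    have "lor (f2 s) (- \<tau> s *\<^sub>R N s) + lor (f3 s) (B s) = 0"
      by (rule derivatives_eq_on_open[OF open_I s _
            lor_has_real_derivative[OF f3[OF s] frenet_equations(3)[OF s]], of "\<lambda>_. 0"])
        (auto simp: f2_eq lor_expand frame_products)
    then show ?thesis
      by (simp add: f2_eq s lor_expand frame_products)
  qed
  show "\<tau> differentiable at s" if s: "s \<in> I" for s
  proof (rule differentiable[OF _ s])
    show "((\<lambda>t. lor (f3 t) (B t) / \<kappa> t) has_real_derivative
        ((lor (f3 s) (- \<tau> s *\<^sub>R N s) + lor (f4 s) (B s)) * \<kappa> s - lor (f3 s) (B s) * deriv \<kappa> s)
          / (\<kappa> s * \<kappa> s)) (at s)"
      by (rule DERIV_divide[OF lor_has_real_derivative[OF f4[OF s] frenet_equations(3)[OF s]]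
            curvature_derivative'[OF s]])
        (use curvature_pos[OF s] in simp)
    show "lor (f3 t) (B t) / \<kappa> t = \<tau> t" if "t \<in> I" for t
      using binormal[OF that] curvature_pos[OF that] by simp
  qed
qed

section \<open>The height of the curve in a fixed direction\<close>

lemma height_tangent_normal:
  assumes height: "\<And>s. s \<in> I \<Longrightarrow> lor (\<alpha> s) a = \<sigma>" and s: "s \<in> I"
  shows "lor (T s) a = 0" and "\<kappa> s * lor (N s) a = - \<sigma>"
proof -
  have T: "lor (T s) a = 0" if s: "s \<in> I" for s
    using derivatives_eq_on_open[OF open_I s height
        lor_has_real_derivative[OF curve_derivative[OF s] has_vector_derivative_const]
        DERIV_const]
    by (simp add: lor.zero_right)
  have "lor (\<kappa> s *\<^sub>R N s + \<alpha> s) a = 0"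
    using derivatives_eq_on_open[OF open_I s T
        lor_has_real_derivative[OF frenet_equations(1)[OF s] has_vector_derivative_const]
        DERIV_const]
    by (simp add: lor.zero_right)
  then show "\<kappa> s * lor (N s) a = - \<sigma>"
    by (simp add: lor_expand height s)
  show "lor (T s) a = 0"
    using s by (rule T)
qed

text \<open>
  Here \<open>\<sigma> = 0\<close>, so \<open>a\<close> is orthogonal to \<open>\<alpha>\<close>, \<open>T\<close> and \<open>N\<close> all along the curve. The derivative of
  \<open>lor N a\<close> is then \<open>\<tau> * lor B a\<close>, and \<open>lor B a\<close> cannot vanish for a nonzero \<open>a\<close>.
\<close>

theorem torsion_zero_of_totally_geodesic:
  assumes "totally_geodesic_plane S" "\<alpha> ` I \<subseteq> S" and s: "s \<in> I"
  shows "\<tau> s = 0"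
proof (rule ccontr)
  assume \<tau>: "\<tau> s \<noteq> 0"
  obtain a where a: "lor a a = 1" and S: "S = umb a 0"
    using assms(1) by (auto simp: totally_geodesic_plane_def)
  have height: "lor (\<alpha> t) a = 0" if "t \<in> I" for t
    using assms(2) that by (auto simp: S umb_def)
  have T: "lor (T t) a = 0" and N: "lor (N t) a = 0" if "t \<in> I" for t
    using height_tangent_normal[OF height that] curvature_pos[OF that] by auto
  have "lor (- \<kappa> s *\<^sub>R T s + \<tau> s *\<^sub>R B s) a = 0"
    using derivatives_eq_on_open[OF open_I s N
        lor_has_real_derivative[OF frenet_equations(2)[OF s] has_vector_derivative_const]
        DERIV_const]
    by (simp add: lor.zero_right)
  then have "lor (B s) a = 0"
    using \<tau> T[OF s] by (simp add: lor_expand)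
  then have "a = 0"
    using orthogonal_to_frame_imp_zero[OF frame[OF s] T[OF s] N[OF s] _ height[OF s]] by simp
  with a show False
    by (simp add: lor.zero_right)
qed

text \<open>
  Without torsion \<open>B\<close> is constant: it is the unit normal of the plane containing the curve.
\<close>

theorem totally_geodesic_of_torsion_zero:
  assumes "\<And>s. s \<in> I \<Longrightarrow> \<tau> s = 0"
  shows "\<exists>S. totally_geodesic_plane S \<and> \<alpha> ` I \<subseteq> S"
proof -
  obtain a where a: "\<And>s. s \<in> I \<Longrightarrow> B s = a"
    using constant_of_zero_derivative[of B] frenet_equations(3) assms by auto
  have "lor a a = 1"
    using nonempty_I a frame_products(3) by auto
  moreover have sub: "\<alpha> ` I \<subseteq> umb a 0"
    using in_hyp3 a frame_products(15) by (auto simp: umb_def)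
  ultimately have "totally_geodesic_plane (umb a 0)"
    using nonempty_I by (auto simp: totally_geodesic_plane_def)
  with sub show ?thesis
    by blast
qed

text \<open>
  The equation compares two expressions for the derivative of \<open>lor B a / \<sigma>\<close>: one from
  \<open>B' = - \<tau> N\<close>, the other from the value of \<open>lor B a\<close> found by differentiating \<open>lor N a = - \<sigma> / \<kappa>\<close>.
\<close>

theorem curvature_equation_of_umbilical:
  assumes umbilical: "totally_umbilical_surface S" "\<not> totally_geodesic_plane S" "\<alpha> ` I \<subseteq> S"
    and torsion: "\<And>s. s \<in> I \<Longrightarrow> \<tau> s \<noteq> 0" and s: "s \<in> I"
  shows "\<tau> s / \<kappa> s - deriv (\<lambda>t. deriv \<kappa> t / ((\<kappa> t)\<^sup>2 * \<tau> t)) s = 0"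
proof -
  obtain a \<sigma> where \<sigma>: "\<sigma> \<noteq> 0" and S: "S = umb a \<sigma>"
  proof -
    have "equidistant_surface S \<or> horosphere S \<or> geodesic_sphere S"
      using umbilical(1,2) by (auto simp: totally_umbilical_surface_def)
    moreover have "\<sigma> \<noteq> 0" if "\<bar>\<sigma>\<bar> > 1" for \<sigma> :: real
      using that by auto
    ultimately have "\<exists>a \<sigma>. \<sigma> \<noteq> 0 \<and> S = umb a \<sigma>"
      unfolding equidistant_surface_def horosphere_def geodesic_sphere_def by blast
    then show ?thesis
      using that by blast
  qed
  have height: "lor (\<alpha> t) a = \<sigma>" if "t \<in> I" for t
    using umbilical(3) that by (auto simp: S umb_def)
  have T: "lor (T t) a = 0" if "t \<in> I" for t
    using height_tangent_normal(1)[OF height that] .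
  have N: "lor (N t) a = - \<sigma> / \<kappa> t" if "t \<in> I" for t
    using height_tangent_normal(2)[OF height that] curvature_pos[OF that]
    by (simp add: field_simps)
  have B: "lor (B t) a = \<sigma> * (deriv \<kappa> t / ((\<kappa> t)\<^sup>2 * \<tau> t))" if t: "t \<in> I" for t
  proof -
    have "((\<lambda>u. - \<sigma> / \<kappa> u) has_real_derivative \<sigma> * deriv \<kappa> t / (\<kappa> t)\<^sup>2) (at t)"
      using curvature_pos[OF t]
      by (auto intro!: derivative_eq_intros curvature_derivative t simp: power2_eq_square)
    then have "lor (- \<kappa> t *\<^sub>R T t + \<tau> t *\<^sub>R B t) a = \<sigma> * deriv \<kappa> t / (\<kappa> t)\<^sup>2"
      using derivatives_eq_on_open[OF open_I t N
          lor_has_real_derivative[OF frenet_equations(2)[OF t] has_vector_derivative_const]]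
      by (simp add: lor.zero_right)
    then show ?thesis
      using torsion[OF t] curvature_pos[OF t] T[OF t] by (simp add: lor_expand field_simps)
  qed
  have "((\<lambda>t. lor (B t) a / \<sigma>) has_real_derivative \<tau> s / \<kappa> s) (at s)"
    using DERIV_cdivide[OF lor_has_real_derivative[OF frenet_equations(3)[OF s]
          has_vector_derivative_const[of a]], of \<sigma>] \<sigma> N[OF s]
    by (simp add: lor_expand lor.zero_right)
  then have "((\<lambda>t. deriv \<kappa> t / ((\<kappa> t)\<^sup>2 * \<tau> t)) has_real_derivative \<tau> s / \<kappa> s) (at s)"
    using open_I s by (rule has_field_derivative_transform_within_open) (simp add: B \<sigma>)
  then show ?thesis
    by (simp add: DERIV_imp_deriv)
qed

text \<open>
  The vector \<open>a\<close> is the one whose frame components are forced by height \<open>\<sigma> = 1\<close>. As \<open>\<alpha>\<close> is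
  timelike, its component along \<open>\<alpha>\<close> is \<open>-1\<close>, and \<open>lor a a\<close> is \<open>-1\<close> plus the squares of the
  components along \<open>N\<close> and \<open>B\<close>, the first of which is not zero.
\<close>

lemma constant_height_of_curvature_equation:
  assumes torsion: "\<And>s. s \<in> I \<Longrightarrow> \<tau> s \<noteq> 0"
    and eq: "\<And>s. s \<in> I \<Longrightarrow> \<tau> s / \<kappa> s - deriv (\<lambda>t. deriv \<kappa> t / ((\<kappa> t)\<^sup>2 * \<tau> t)) s = 0"
  obtains a where "lor a a > -1" and "\<And>s. s \<in> I \<Longrightarrow> lor (\<alpha> s) a = 1"
proof -
  define f where "f = (\<lambda>t. deriv \<kappa> t / ((\<kappa> t)\<^sup>2 * \<tau> t))"
  define A where "A = (\<lambda>t. - (1 / \<kappa> t) *\<^sub>R N t + f t *\<^sub>R B t - \<alpha> t)"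
  have A': "(A has_vector_derivative 0) (at s)" if s: "s \<in> I" for s
  proof -
    have \<kappa>: "\<kappa> s > 0"
      by (rule curvature_pos[OF s])
    have "f differentiable at s"
      unfolding f_def using \<kappa> torsion[OF s]
      by (intro differentiable_divide differentiable_mult differentiable_power
          curvature_twice_differentiable torsion_differentiable s)
        (use curvature_derivative[OF s] in \<open>auto simp: real_differentiable_def\<close>)
    then have f': "(f has_real_derivative \<tau> s / \<kappa> s) (at s)"
      using eq[OF s] by (auto simp: f_def[symmetric] real_differentiable_def DERIV_imp_deriv)
    have g': "((\<lambda>t. - (1 / \<kappa> t)) has_real_derivative f s * \<tau> s) (at s)"
      using \<kappa> torsion[OF s]
      by (auto intro!: derivative_eq_intros curvature_derivative s
          simp: f_def power2_eq_square)
    show ?thesis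
      unfolding A_def
      by (rule has_vector_derivative_eq_rhs,
          rule has_vector_derivative_diff[OF has_vector_derivative_add[OF
              has_vector_derivative_scaleR[OF g' frenet_equations(2)[OF s]]
              has_vector_derivative_scaleR[OF f' frenet_equations(3)[OF s]]]
            curve_derivative[OF s]])
        (use \<kappa> in \<open>simp add: algebra_simps\<close>)
  qed
  obtain a where a: "\<And>s. s \<in> I \<Longrightarrow> A s = a"
    using constant_of_zero_derivative A' by blast
  have "lor (\<alpha> s) a = 1" if "s \<in> I" for s
    unfolding a[OF that, symmetric] A_def
    by (simp add: lor_expand frame_products that lor_curve)
  moreover obtain s where s: "s \<in> I"
    using nonempty_I by auto
  have "lor a a = (1 / \<kappa> s)\<^sup>2 + (f s)\<^sup>2 - 1"
    unfolding a[OF s, symmetric] A_def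
    by (simp add: lor_expand frame_products s lor_curve power2_eq_square)
  then have "lor a a > -1"
    using curvature_pos[OF s] by (simp add: add_pos_nonneg)
  ultimately show ?thesis
    using that by blast
qed

text \<open>
  The level set is not itself a totally geodesic plane, presented by another vector, because the
  curve in it has torsion.
\<close>

theorem umbilical_of_curvature_equation:
  assumes torsion: "\<And>s. s \<in> I \<Longrightarrow> \<tau> s \<noteq> 0"
    and eq: "\<And>s. s \<in> I \<Longrightarrow> \<tau> s / \<kappa> s - deriv (\<lambda>t. deriv \<kappa> t / ((\<kappa> t)\<^sup>2 * \<tau> t)) s = 0"
  shows "\<exists>S. totally_umbilical_surface S \<and> \<not> totally_geodesic_plane S \<and> \<alpha> ` I \<subseteq> S"
proof -
  obtain a where a: "lor a a > -1" and height: "\<And>s. s \<in> I \<Longrightarrow> lor (\<alpha> s) a = 1"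
    using constant_height_of_curvature_equation[OF torsion eq] by blast
  have sub: "\<alpha> ` I \<subseteq> umb a 1"
    using height in_hyp3 by (auto simp: umb_def)
  then have "totally_umbilical_surface (umb a 1)"
    using totally_umbilical_surface_umb_1[OF a] nonempty_I by auto
  moreover have "\<not> totally_geodesic_plane (umb a 1)"
    using torsion_zero_of_totally_geodesic[OF _ sub] torsion nonempty_I by blast
  ultimately show ?thesis
    using sub by blast
qed

end

section \<open>The characterisation\<close>

theorem theorem1p2:
  fixes I :: "real set" and \<alpha> T N B :: "real \<Rightarrow> real^4" and \<kappa> \<tau> :: "real \<Rightarrow> real" and \<omega> :: real
  assumes "open I" and "is_interval I" and "I \<noteq> {}"
    and "arclength_curve I \<alpha>"
    and "\<omega> = 1 \<or> \<omega> = -1"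
    and "frenet_apparatus \<omega> I \<alpha> T N B \<kappa> \<tau>"
    and "\<forall>s\<in>I. \<kappa> s > 0"
  shows "((\<exists>S. totally_geodesic_plane S \<and> \<alpha> ` I \<subseteq> S) \<longleftrightarrow> (\<forall>s\<in>I. \<tau> s = 0)) \<and>
    ((\<forall>s\<in>I. \<tau> s \<noteq> 0 \<and> deriv \<kappa> s \<noteq> 0) \<longrightarrow>
      ((\<exists>S. totally_umbilical_surface S \<and> \<not> totally_geodesic_plane S \<and> \<alpha> ` I \<subseteq> S) \<longleftrightarrow>
       (\<forall>s\<in>I. \<tau> s / \<kappa> s - deriv (\<lambda>t. deriv \<kappa> t / ((\<kappa> t)\<^sup>2 * \<tau> t)) s = 0)))"
proof -
  interpret frenet_curve \<omega> I \<alpha> T N B \<kappa> \<tau>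
    using assms by unfold_locales auto
  show ?thesis
  proof (intro conjI impI iffI ballI)
    show "\<tau> s = 0" if "\<exists>S. totally_geodesic_plane S \<and> \<alpha> ` I \<subseteq> S" "s \<in> I" for s
      using that torsion_zero_of_totally_geodesic by blast
    show "\<exists>S. totally_geodesic_plane S \<and> \<alpha> ` I \<subseteq> S" if "\<forall>s\<in>I. \<tau> s = 0"
      using that by (intro totally_geodesic_of_torsion_zero) blast
  next
    assume nonzero: "\<forall>s\<in>I. \<tau> s \<noteq> 0 \<and> deriv \<kappa> s \<noteq> 0"
    show "\<tau> s / \<kappa> s - deriv (\<lambda>t. deriv \<kappa> t / ((\<kappa> t)\<^sup>2 * \<tau> t)) s = 0"
      if surface: "\<exists>S. totally_umbilical_surface S \<and> \<not> totally_geodesic_plane S \<and> \<alpha> ` I \<subseteq> S"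
        and s: "s \<in> I" for s
    proof -
      obtain S where "totally_umbilical_surface S" "\<not> totally_geodesic_plane S" "\<alpha> ` I \<subseteq> S"
        using surface by blast
      then show ?thesis
        using nonzero s by (intro curvature_equation_of_umbilical) auto
    qed
    show "\<exists>S. totally_umbilical_surface S \<and> \<not> totally_geodesic_plane S \<and> \<alpha> ` I \<subseteq> S"
      if "\<forall>s\<in>I. \<tau> s / \<kappa> s - deriv (\<lambda>t. deriv \<kappa> t / ((\<kappa> t)\<^sup>2 * \<tau> t)) s = 0"
      using nonzero that by (intro umbilical_of_curvature_equation) auto
  qed
qed

end
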